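(* Let $n\ge1$, and suppose that a nonnegative number $h_{\mathcal A}$ is given for every antichain $\mathcal A$ of subsets of $\{1,\dots,n\}$. For any measure of shared information $I_\cap$ that satisfies the combined secret sharing property, there exist random variables $S,X_1,\dots,X_n$ such that the corresponding partial measure $I_\partial$ satisfies $$I_\partial(S;A_1,\dots,A_k)=h_{(A_1,\dots,A_k)}$$ for all antichains $(A_1,\dots,A_k)$ of subsets of $\{1,\dots,n\}$.
   Context: All random variables take finitely many values; $H$ is Shannon entropy. For $A\subseteq\{1,\dots,n\}$ write $X_A=(X_i)_{i\in A}$ ($X_\emptyset$ is constant). **Measure of shared information.** A function $I_\cap$ assigning to jointly distributed random variables $S$ (the target) and $Y_1,\dots,Y_k$ ($k\ge1$) a real number $I_\cap(S;Y_1,\dots,Y_k)$, symmetric in $Y_1,\dots,Y_k$. Given $X_1,\dots,X_n$ and $A_1,\dots,A_k\subseteq\{1,\dots,n\}$, write $I_\cap(S;A_1,\dots,A_k):=I_\cap(S;X_{A_1},\dots,X_{A_k})$. **Access structures and secret sharing.** An access structure $\mathcal A$ on $\{1,\dots,n\}$ is a family of subsets of $\{1,\dots,n\}$ closed under taking supersets; its elements are called authorized. A perfect secret sharing scheme with access structure $\mathcal A$ is a family of random variables $S,X_1,\dots,X_n$ with $H(X_A,S)=H(X_A)$ whenever $A\in\mathcal A$ and $H(X_A,S)=H(X_A)+H(S)$ whenever $A\notin\mathcal A$. A combination of perfect secret sharing schemes with access structures $\mathcal A_1,\dots,\mathcal A_l$ on $\{1,\dots,n\}$ consists of random variables $S_1,\dots,S_l,X_1,\dots,X_n$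 such that for each $i$, $(S_i,X_1,\dots,X_n)$ is a perfect secret sharing scheme with access structure $\mathcal A_i$, and $H(S_i\mid S_1,\dots,S_{i-1},S_{i+1},\dots,S_l,X_A)=H(S_i)$ whenever $A\notin\mathcal A_i$. **Combined secret sharing property.** For every combination of perfect secret sharing schemes with access structures $\mathcal A_1,\dots,\mathcal A_l$ on $\{1,\dots,n\}$ (any $n$, $l$) and all $A_1,\dots,A_k\subseteq\{1,\dots,n\}$, $$I_\cap\big((S_1,\dots,S_l);A_1,\dots,A_k\big)=H\big(\{S_i: A_1,\dots,A_k\in\mathcal A_i\}\big),$$ the joint entropy of those secrets for which all of $A_1,\dots,A_k$ are authorized (zero if there is none). **Partial information terms.** An antichain is a nonempty collection $(A_1,\dots,A_k)$ of nonempty subsets of $\{1,\dots,n\}$, none contained in another; the order of the elements is irrelevant. Antichains are ordered by: $(A_1,\dots,A_k)\preceq(B_1,\dots,B_l)$ iff for every $B_i$ there is an $A_j$ with $A_j\subseteq B_i$. For given $S,X_1,\dots,X_n$, the function $I_\partial(S;\cdot)$ on antichains is the unique one (Möbius inversion) with $$I_\cap(S;A_1,\dots,A_k)=\sum_{(B_1,\dots,B_l)\preceq(A_1,\dots,A_k)}I_\partial(S;B_1,\dots,B_l)$$ for all antichains $(A_1,\dots,A_k)$. *)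

theory Defs
  imports "HOL-Probability.Probability"
begin

text \<open>
  All random variables take values in one universe that is closed under forming finite tuples, so
  that a measure of shared information can be a single function that accepts the individual
  variables as well as tuples such as \<open>X\<^sub>A\<close> and \<open>(S\<^sub>1, \<dots>, S\<^sub>l)\<close>.
\<close>

datatype val = Atom nat | Tuple "val list"

text \<open>
  A random variable with finitely many values on a probability space \<open>M\<close> is a
  \<^const>\<open>simple_function\<close>.
\<close>

definition tuple_rv :: "(nat \<Rightarrow> 'w \<Rightarrow> val) \<Rightarrow> nat set \<Rightarrow> 'w \<Rightarrow> val" where
  "tuple_rv X A = (\<lambda>\<omega>. Tuple (map (\<lambda>i. X i \<omega>) (sorted_list_of_set A)))"

text \<open>
  For \<open>prob_space M\<close> these are the library's \<open>\<H>(X)\<close> and \<open>\<H>(X | Y)\<close> with base \<open>b = 2\<close>.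
\<close>

definition shannon_entropy :: "'w measure \<Rightarrow> ('w \<Rightarrow> 'v) \<Rightarrow> real" where
  "shannon_entropy M X = prob_space.entropy M 2 (count_space (X ` space M)) X"

definition cond_shannon_entropy :: "'w measure \<Rightarrow> ('w \<Rightarrow> 'v) \<Rightarrow> ('w \<Rightarrow> 'u) \<Rightarrow> real" where
  "cond_shannon_entropy M X Y =
     prob_space.conditional_entropy M 2 (count_space (X ` space M)) (count_space (Y ` space M)) X Y"

text \<open>
  \<open>I M S [Y\<^sub>1, \<dots>, Y\<^sub>k]\<close> stands for \<open>I\<^sub>\<inter>(S; Y\<^sub>1, \<dots>, Y\<^sub>k)\<close>, where \<open>M\<close> is the underlying probability
  space. Only the values on probability spaces, simple functions and nonempty lists matter. Nothing
  is assumed about how \<open>I\<close> depends on its arguments beyond symmetry; in particular it need not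
  depend only on the joint distribution. The type \<open>'w\<close> of sample points is arbitrary; a function
  defined on all probability spaces restricts to those over a given \<open>'w\<close>. Finite types \<open>'w\<close> are too
  small to carry all finite joint distributions, infinite ones are not.
\<close>

type_synonym 'w shared_info = "'w measure \<Rightarrow> ('w \<Rightarrow> val) \<Rightarrow> ('w \<Rightarrow> val) list \<Rightarrow> real"

definition shared_information_measure :: "'w shared_info \<Rightarrow> bool" where
  "shared_information_measure I \<longleftrightarrow>
     (\<forall>M S Ys Zs. prob_space M \<longrightarrow> simple_function M S \<longrightarrow> (\<forall>Y\<in>set Ys. simple_function M Y) \<longrightarrow>
        Ys \<noteq> [] \<longrightarrow> mset Zs = mset Ys \<longrightarrow> I M S Zs = I M S Ys)"

definition shared_of_sets ::
  "'w shared_info \<Rightarrow> 'w measure \<Rightarrow> ('w \<Rightarrow> val) \<Rightarrow> (nat \<Rightarrow> 'w \<Rightarrow> val) \<Rightarrow> nat set list \<Rightarrow> real" where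
  "shared_of_sets I M S X As = I M S (map (tuple_rv X) As)"

definition access_structure :: "nat \<Rightarrow> nat set set \<Rightarrow> bool" where
  "access_structure n \<A> \<longleftrightarrow>
     \<A> \<subseteq> Pow {1..n} \<and> (\<forall>A\<in>\<A>. \<forall>B. A \<subseteq> B \<and> B \<subseteq> {1..n} \<longrightarrow> B \<in> \<A>)"

definition perfect_secret_sharing ::
  "nat \<Rightarrow> nat set set \<Rightarrow> 'w measure \<Rightarrow> ('w \<Rightarrow> val) \<Rightarrow> (nat \<Rightarrow> 'w \<Rightarrow> val) \<Rightarrow> bool" where
  "perfect_secret_sharing n \<A> M S X \<longleftrightarrow>
     simple_function M S \<and> (\<forall>i\<in>{1..n}. simple_function M (X i)) \<and>
     (\<forall>A\<in>\<A>. shannon_entropy M (\<lambda>\<omega>. (tuple_rv X A \<omega>, S \<omega>)) = shannon_entropy M (tuple_rv X A)) \<and>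
     (\<forall>A. A \<subseteq> {1..n} \<and> A \<notin> \<A> \<longrightarrow>
        shannon_entropy M (\<lambda>\<omega>. (tuple_rv X A \<omega>, S \<omega>)) =
          shannon_entropy M (tuple_rv X A) + shannon_entropy M S)"

definition combined_secret_sharing ::
  "nat \<Rightarrow> nat \<Rightarrow> (nat \<Rightarrow> nat set set) \<Rightarrow> 'w measure \<Rightarrow> (nat \<Rightarrow> 'w \<Rightarrow> val) \<Rightarrow> (nat \<Rightarrow> 'w \<Rightarrow> val) \<Rightarrow> bool"
  where
  "combined_secret_sharing n l \<A> M S X \<longleftrightarrow>
     (\<forall>i\<in>{1..l}. perfect_secret_sharing n (\<A> i) M (S i) X \<and>
        (\<forall>A. A \<subseteq> {1..n} \<and> A \<notin> \<A> i \<longrightarrow>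
           cond_shannon_entropy M (S i) (\<lambda>\<omega>. (tuple_rv S ({1..l} - {i}) \<omega>, tuple_rv X A \<omega>)) =
             shannon_entropy M (S i)))"

text \<open>
  If no secret has all of \<open>A\<^sub>1, \<dots>, A\<^sub>k\<close> authorized, then the tuple on the right-hand side below is
  constant and its entropy is zero.
\<close>

definition combined_secret_sharing_property :: "'w shared_info \<Rightarrow> bool" where
  "combined_secret_sharing_property I \<longleftrightarrow>
     (\<forall>n l \<A> M S X As.
        1 \<le> n \<longrightarrow> 1 \<le> l \<longrightarrow> (\<forall>i\<in>{1..l}. access_structure n (\<A> i)) \<longrightarrow>
        prob_space M \<longrightarrow> combined_secret_sharing n l \<A> M S X \<longrightarrow>
        As \<noteq> [] \<longrightarrow> (\<forall>A\<in>set As. A \<subseteq> {1..n}) \<longrightarrow>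
        shared_of_sets I M (tuple_rv S {1..l}) X As =
          shannon_entropy M (tuple_rv S {i\<in>{1..l}. \<forall>A\<in>set As. A \<in> \<A> i}))"

definition antichain :: "nat \<Rightarrow> nat set set \<Rightarrow> bool" where
  "antichain n \<alpha> \<longleftrightarrow>
     \<alpha> \<noteq> {} \<and> (\<forall>A\<in>\<alpha>. A \<noteq> {} \<and> A \<subseteq> {1..n}) \<and> (\<forall>A\<in>\<alpha>. \<forall>B\<in>\<alpha>. A \<subseteq> B \<longrightarrow> A = B)"

definition antichain_le :: "nat set set \<Rightarrow> nat set set \<Rightarrow> bool" (infix \<open>\<preceq>\<close> 50) where
  "\<alpha> \<preceq> \<beta> \<longleftrightarrow> (\<forall>B\<in>\<beta>. \<exists>A\<in>\<alpha>. A \<subseteq> B)"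

text \<open>
  The Moebius inverse \<open>I\<^sub>\<partial>(S; \<cdot>)\<close> is a function on antichains; outside of them it is set to zero to
  make it unique as a total function. Lists enumerate antichains, in any order.
\<close>

definition moebius_inverse ::
  "'w shared_info \<Rightarrow> nat \<Rightarrow> 'w measure \<Rightarrow> ('w \<Rightarrow> val) \<Rightarrow> (nat \<Rightarrow> 'w \<Rightarrow> val) \<Rightarrow>
   (nat set set \<Rightarrow> real) \<Rightarrow> bool" where
  "moebius_inverse I n M S X f \<longleftrightarrow>
     (\<forall>\<alpha>. \<not> antichain n \<alpha> \<longrightarrow> f \<alpha> = 0) \<and>
     (\<forall>As. distinct As \<longrightarrow> antichain n (set As) \<longrightarrow>
        shared_of_sets I M S X As = (\<Sum>\<beta> | antichain n \<beta> \<and> \<beta> \<preceq> set As. f \<beta>))"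

definition partial_information ::
  "'w shared_info \<Rightarrow> nat \<Rightarrow> 'w measure \<Rightarrow> ('w \<Rightarrow> val) \<Rightarrow> (nat \<Rightarrow> 'w \<Rightarrow> val) \<Rightarrow> nat set set \<Rightarrow> real" where
  "partial_information I n M S X = (THE f. moebius_inverse I n M S X f)"

text \<open>The remaining lemmas show that the definite description above is well-defined.\<close>

lemma finite_antichains: "finite {\<alpha>. antichain n \<alpha>}"
  by (rule finite_subset[of _ "Pow (Pow {1..n})"]) (auto simp: antichain_def)

lemma antichain_le_refl: "\<alpha> \<preceq> \<alpha>"
  by (auto simp: antichain_le_def)

lemma antichain_le_trans: "\<alpha> \<preceq> \<beta> \<Longrightarrow> \<beta> \<preceq> \<gamma> \<Longrightarrow> \<alpha> \<preceq> \<gamma>"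
  unfolding antichain_le_def by (meson subset_trans)

lemma antichain_le_antisym:
  assumes "antichain n \<alpha>" "antichain n \<beta>" "\<alpha> \<preceq> \<beta>" "\<beta> \<preceq> \<alpha>"
  shows "\<alpha> = \<beta>"
proof -
  have sub: "\<gamma> \<subseteq> \<delta>"
    if anti: "antichain n \<gamma>" and le: "\<gamma> \<preceq> \<delta>" "\<delta> \<preceq> \<gamma>" for \<gamma> \<delta>
  proof
    fix A assume A: "A \<in> \<gamma>"
    obtain B where B: "B \<in> \<delta>" "B \<subseteq> A" using le(2) A by (auto simp: antichain_le_def)
    obtain C where C: "C \<in> \<gamma>" "C \<subseteq> B" using le(1) B by (auto simp: antichain_le_def)
    have "C = A" using anti A B C unfolding antichain_def by (meson subset_trans)
    with B C show "A \<in> \<delta>" by auto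
  qed
  show ?thesis using sub[of \<alpha> \<beta>] sub[of \<beta> \<alpha>] assms by blast
qed

lemma moebius_inversion_ex:
  fixes g :: "nat set set \<Rightarrow> real"
  shows "\<exists>f. (\<forall>\<alpha>. \<not> antichain n \<alpha> \<longrightarrow> f \<alpha> = 0) \<and>
           (\<forall>\<alpha>. antichain n \<alpha> \<longrightarrow> g \<alpha> = (\<Sum>\<beta> | antichain n \<beta> \<and> \<beta> \<preceq> \<alpha>. f \<beta>))"
proof -
  define D where "D \<alpha> = {\<beta>. antichain n \<beta> \<and> \<beta> \<preceq> \<alpha>}" for \<alpha>
  have fin: "finite (D \<alpha>)" for \<alpha>
    by (rule finite_subset[OF _ finite_antichains[of n]]) (auto simp: D_def)
  have less: "card (D \<beta>) < card (D \<alpha>)" if "antichain n \<alpha>" "\<beta> \<in> D \<alpha>" "\<beta> \<noteq> \<alpha>" for \<alpha> \<beta>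
  proof (rule psubset_card_mono[OF fin])
    show "D \<beta> \<subset> D \<alpha>"
    proof (rule psubsetI)
      show "D \<beta> \<subseteq> D \<alpha>"
        using that(2) antichain_le_trans[of _ \<beta> \<alpha>] by (auto simp: D_def)
      have "\<alpha> \<notin> D \<beta>"
        using that antichain_le_antisym[of n \<alpha> \<beta>] by (auto simp: D_def)
      moreover have "\<alpha> \<in> D \<alpha>" using that(1) antichain_le_refl[of \<alpha>] by (simp add: D_def)
      ultimately show "D \<beta> \<noteq> D \<alpha>" by metis
    qed
  qed
  have "\<exists>f. (\<forall>\<alpha>. \<not> antichain n \<alpha> \<longrightarrow> f \<alpha> = 0) \<and>
          (\<forall>\<alpha>. antichain n \<alpha> \<and> card (D \<alpha>) \<le> m \<longrightarrow> g \<alpha> = sum f (D \<alpha>))" for m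
  proof (induction m)
    case 0
    have "\<not> card (D \<alpha>) \<le> 0" if "antichain n \<alpha>" for \<alpha>
      using fin[of \<alpha>] that antichain_le_refl[of \<alpha>] by (auto simp: D_def)
    then show ?case by (intro exI[of _ "\<lambda>_. 0"]) blast
  next
    case (Suc m)
    then obtain f where f: "\<forall>\<alpha>. \<not> antichain n \<alpha> \<longrightarrow> f \<alpha> = 0"
      "\<forall>\<alpha>. antichain n \<alpha> \<and> card (D \<alpha>) \<le> m \<longrightarrow> g \<alpha> = sum f (D \<alpha>)" by blast
    define f' where "f' \<alpha> = (if antichain n \<alpha> \<and> card (D \<alpha>) = Suc m
      then g \<alpha> - sum f (D \<alpha> - {\<alpha>}) else f \<alpha>)" for \<alpha>
    have "g \<alpha> = sum f' (D \<alpha>)" if a: "antichain n \<alpha>" "card (D \<alpha>) \<le> Suc m" for \<alpha>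
    proof -
      have eq: "sum f' (D \<alpha> - {\<alpha>}) = sum f (D \<alpha> - {\<alpha>})"
        using less[OF a(1)] a(2) by (intro sum.cong) (fastforce simp: f'_def)+
      have "\<alpha> \<in> D \<alpha>" using a antichain_le_refl by (auto simp: D_def)
      then have s: "sum h (D \<alpha>) = h \<alpha> + sum h (D \<alpha> - {\<alpha>})" for h :: "_ \<Rightarrow> real"
        by (rule sum.remove[OF fin])
      show ?thesis using a f(2) by (cases "card (D \<alpha>) = Suc m") (auto simp: s eq, auto simp: f'_def s)
    qed
    moreover have "\<forall>\<alpha>. \<not> antichain n \<alpha> \<longrightarrow> f' \<alpha> = 0" using f(1) by (simp add: f'_def)
    ultimately show ?case by blast
  qed
  from this[of "card {\<alpha>. antichain n \<alpha>}"] obtain f where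
    f: "\<forall>\<alpha>. \<not> antichain n \<alpha> \<longrightarrow> f \<alpha> = 0"
      "\<forall>\<alpha>. antichain n \<alpha> \<and> card (D \<alpha>) \<le> card {\<alpha>. antichain n \<alpha>} \<longrightarrow> g \<alpha> = sum f (D \<alpha>)" by blast
  have "card (D \<alpha>) \<le> card {\<alpha>. antichain n \<alpha>}" for \<alpha>
    by (rule card_mono[OF finite_antichains]) (auto simp: D_def)
  with f show ?thesis unfolding D_def by blast
qed

lemma moebius_inversion_unique:
  fixes f f' :: "nat set set \<Rightarrow> real"
  assumes "\<And>\<alpha>. antichain n \<alpha> \<Longrightarrow>
    (\<Sum>\<beta> | antichain n \<beta> \<and> \<beta> \<preceq> \<alpha>. f \<beta>) = (\<Sum>\<beta> | antichain n \<beta> \<and> \<beta> \<preceq> \<alpha>. f' \<beta>)"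
    and "antichain n \<alpha>"
  shows "f \<alpha> = f' \<alpha>"
  using assms(2)
proof (induction "card {\<beta>. antichain n \<beta> \<and> \<beta> \<preceq> \<alpha>}" arbitrary: \<alpha> rule: less_induct)
  case less
  let ?D = "\<lambda>\<alpha>. {\<beta>. antichain n \<beta> \<and> \<beta> \<preceq> \<alpha>}"
  have fin: "finite (?D \<alpha>)"
    by (rule finite_subset[OF _ finite_antichains[of n]]) auto
  have eq: "f \<beta> = f' \<beta>" if "\<beta> \<in> ?D \<alpha> - {\<alpha>}" for \<beta>
  proof (rule less.hyps)
    have "?D \<beta> \<subseteq> ?D \<alpha>"
      using that antichain_le_trans[of _ \<beta> \<alpha>] by auto
    moreover have "\<alpha> \<notin> ?D \<beta>" "\<alpha> \<in> ?D \<alpha>"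
      using that less.prems antichain_le_antisym[of n \<alpha> \<beta>] antichain_le_refl[of \<alpha>] by auto
    ultimately have "?D \<beta> \<subset> ?D \<alpha>" by (metis psubsetI)
    then show "card (?D \<beta>) < card (?D \<alpha>)" by (rule psubset_card_mono[OF fin])
    show "antichain n \<beta>" using that by simp
  qed
  have "sum f (?D \<alpha> - {\<alpha>}) = sum f' (?D \<alpha> - {\<alpha>})" by (rule sum.cong[OF refl eq])
  moreover have "\<alpha> \<in> ?D \<alpha>" using less.prems antichain_le_refl by auto
  then have "sum h (?D \<alpha>) = h \<alpha> + sum h (?D \<alpha> - {\<alpha>})" for h :: "_ \<Rightarrow> real"
    by (rule sum.remove[OF fin])
  ultimately show ?case using assms(1)[OF less.prems] by (metis add_right_cancel)
qed

lemma simple_function_tuple_rv: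
  assumes "\<And>i. i \<in> A \<Longrightarrow> simple_function M (X i)"
  shows "simple_function M (tuple_rv X A)"
proof (cases "finite A")
  case True
  have "simple_function M (\<lambda>\<omega>. map (\<lambda>i. X i \<omega>) is)" if "set is \<subseteq> A" for "is"
    using that
  proof (induction "is")
    case (Cons i "is")
    then have "simple_function M (\<lambda>\<omega>. (X i \<omega>, map (\<lambda>i. X i \<omega>) is))"
      using assms by (intro simple_function_Pair) auto
    from simple_function_compose[OF this, of "\<lambda>(x, xs). x # xs"]
    show ?case by (simp add: comp_def)
  qed simp
  from simple_function_compose[OF this[of "sorted_list_of_set A"], of Tuple] True
  show ?thesis by (simp add: tuple_rv_def comp_def)
qed (simp add: tuple_rv_def)

lemma partial_information_well_defined:
  assumes "shared_information_measure I" "prob_space M" "simple_function M S"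
    and X: "\<And>i. i \<in> {1..n} \<Longrightarrow> simple_function M (X i)"
  shows "\<exists>!f. moebius_inverse I n M S X f"
proof -
  define g where "g \<alpha> = shared_of_sets I M S X (SOME As. distinct As \<and> set As = \<alpha>)" for \<alpha>
  have g: "shared_of_sets I M S X As = g (set As)" if "distinct As" "antichain n (set As)" for As
  proof -
    define Bs where "Bs = (SOME Bs. distinct Bs \<and> set Bs = set As)"
    have Bs: "distinct Bs \<and> set Bs = set As"
      unfolding Bs_def by (rule someI[of _ As]) (use that in simp)
    then have "mset Bs = mset As" using that(1) set_eq_iff_mset_eq_distinct by blast
    moreover have "simple_function M (tuple_rv X A)" if "A \<in> set As" for A
    proof (rule simple_function_tuple_rv)
      fix i assume "i \<in> A"
      moreover have "A \<subseteq> {1..n}"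
        using that \<open>antichain n (set As)\<close> unfolding antichain_def by blast
      ultimately show "simple_function M (X i)" using X by blast
    qed
    moreover have "As \<noteq> []" using that(2) by (auto simp: antichain_def)
    ultimately have "shared_of_sets I M S X Bs = shared_of_sets I M S X As"
      using assms(1-3) unfolding shared_information_measure_def shared_of_sets_def by simp
    then show ?thesis by (simp add: g_def Bs_def)
  qed
  have ex: "\<exists>As. distinct As \<and> set As = \<alpha>" if "antichain n \<alpha>" for \<alpha>
    using that finite_distinct_list[of \<alpha>] finite_subset[of \<alpha> "Pow {1..n}"]
    by (auto simp: antichain_def)
  have iff: "moebius_inverse I n M S X f \<longleftrightarrow> (\<forall>\<alpha>. \<not> antichain n \<alpha> \<longrightarrow> f \<alpha> = 0) \<and>
      (\<forall>\<alpha>. antichain n \<alpha> \<longrightarrow> g \<alpha> = (\<Sum>\<beta> | antichain n \<beta> \<and> \<beta> \<preceq> \<alpha>. f \<beta>))" for f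
  proof -
    have "(\<forall>As. distinct As \<longrightarrow> antichain n (set As) \<longrightarrow>
             shared_of_sets I M S X As = (\<Sum>\<beta> | antichain n \<beta> \<and> \<beta> \<preceq> set As. f \<beta>)) \<longleftrightarrow>
          (\<forall>\<alpha>. antichain n \<alpha> \<longrightarrow> g \<alpha> = (\<Sum>\<beta> | antichain n \<beta> \<and> \<beta> \<preceq> \<alpha>. f \<beta>))"
      (is "?L \<longleftrightarrow> ?R")
    proof
      assume L: ?L
      show ?R
      proof (intro allI impI)
        fix \<alpha> assume a: "antichain n \<alpha>"
        obtain As where "distinct As" "set As = \<alpha>" using ex[OF a] by blast
        then show "g \<alpha> = (\<Sum>\<beta> | antichain n \<beta> \<and> \<beta> \<preceq> \<alpha>. f \<beta>)"
          using L[rule_format, of As] g[of As] a by simp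
      qed
    next
      assume ?R
      then show ?L using g by simp
    qed
    then show ?thesis by (simp add: moebius_inverse_def)
  qed
  show ?thesis
  proof (rule ex_ex1I)
    show "\<exists>f. moebius_inverse I n M S X f" unfolding iff by (rule moebius_inversion_ex)
  next
    fix f f' assume "moebius_inverse I n M S X f" "moebius_inverse I n M S X f'"
    then have f: "(\<forall>\<alpha>. \<not> antichain n \<alpha> \<longrightarrow> f \<alpha> = 0) \<and>
        (\<forall>\<alpha>. antichain n \<alpha> \<longrightarrow> g \<alpha> = (\<Sum>\<beta> | antichain n \<beta> \<and> \<beta> \<preceq> \<alpha>. f \<beta>))"
      and f': "(\<forall>\<alpha>. \<not> antichain n \<alpha> \<longrightarrow> f' \<alpha> = 0) \<and>
        (\<forall>\<alpha>. antichain n \<alpha> \<longrightarrow> g \<alpha> = (\<Sum>\<beta> | antichain n \<beta> \<and> \<beta> \<preceq> \<alpha>. f' \<beta>))"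
      by (simp_all only: iff)
    show "f = f'"
    proof
      fix \<alpha>
      show "f \<alpha> = f' \<alpha>"
      proof (cases "antichain n \<alpha>")
        case True
        show ?thesis
        proof (rule moebius_inversion_unique[OF _ True])
          fix \<gamma> assume c: "antichain n \<gamma>"
          show "(\<Sum>\<beta> | antichain n \<beta> \<and> \<beta> \<preceq> \<gamma>. f \<beta>) = (\<Sum>\<beta> | antichain n \<beta> \<and> \<beta> \<preceq> \<gamma>. f' \<beta>)"
            using conjunct2[OF f, rule_format, OF c] conjunct2[OF f', rule_format, OF c] by simp
        qed
      qed (use f f' in simp)
    qed
  qed
qed

end

theory Submission
  imports Defs "HOL-Real_Asymp.Real_Asymp"
begin

text \<open>
  To every antichain \<open>\<alpha>\<close> we associate an independent secret of entropy \<open>h \<alpha>\<close>, shared perfectly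
  among the supersets of the members of \<open>\<alpha>\<close>: with the secret in the integers modulo \<open>N\<close>, the parties
  of each \<open>B \<in> \<alpha>\<close> receive independent uniform shares, and the difference between the secret and the
  sum of the shares in \<open>B\<close> is made public. The combined secret sharing property turns \<open>I\<^sub>\<inter>\<close> into the sum
  of \<open>h \<beta>\<close> over the antichains \<open>\<beta> \<preceq> \<alpha>\<close>, so \<open>h\<close> is its Moebius inverse.
\<close>

section \<open>Distributions of prescribed entropy\<close>

text \<open>At 0 the limit of \<open>x * log 2 x\<close> is 0, which is also its value there.
  Including this endpoint makes entropy continuous even at distributions in which some probabilities
  vanish.\<close>

lemma continuous_on_x_log_x: "continuous_on {0..} (\<lambda>x::real. x * log 2 x)"
proof -
  have "continuous (at x within {0..}) (\<lambda>x::real. x * log 2 x)" if "x \<ge> 0" for x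
  proof (cases "x = 0")
    case True
    have "((\<lambda>x::real. x * log 2 x) \<longlongrightarrow> 0) (at_right 0)"
      by real_asymp
    then show ?thesis
      using True by (simp add: continuous_within at_within_Ici_at_right)
  next
    case False
    then show ?thesis
      using that by (intro continuous_intros continuous_at_imp_continuous_at_within) auto
  qed
  then show ?thesis
    by (simp add: continuous_on_eq_continuous_within)
qed

text \<open>The mixtures \<open>q t\<close> run from the point mass at 0, of entropy 0, to the
  uniform distribution, of entropy \<open>log 2 N\<close>. Entropy is continuous in
  \<open>t\<close>, so the intermediate value theorem hits \<open>h\<close>.\<close>

lemma ex_distribution_with_entropy:
  fixes N :: int
  assumes N: "0 < N" and h: "0 \<le> h" "h \<le> log 2 N"
  shows "\<exists>p :: int \<Rightarrow> real. (\<forall>x. 0 \<le> p x) \<and> (\<Sum>x\<in>{0..<N}. p x) = 1 \<and>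
           - (\<Sum>x\<in>{0..<N}. p x * log 2 (p x)) = h"
proof -
  define q where "q t x = (1 - t) * of_bool (x = 0) + t / N" for t :: real and x :: int
  define H where "H t = - (\<Sum>x\<in>{0..<N}. q t x * log 2 (q t x))" for t
  have q_nonneg: "0 \<le> q t x" if "t \<in> {0..1}" for t x
    using that N by (auto simp: q_def)
  have q_sum: "(\<Sum>x\<in>{0..<N}. q t x) = 1" for t
  proof -
    have "(\<Sum>x\<in>{0..<N}. of_bool (x = 0)) = (1::real)"
      using N by (subst sum.remove[of _ 0]) auto
    then show ?thesis
      using N by (simp add: q_def sum.distrib flip: sum_distrib_left)
  qed
  have "continuous_on {0..1} H"
    unfolding H_def
  proof (intro continuous_on_minus continuous_on_sum)
    fix x
    have "continuous_on {0..1} (\<lambda>t. q t x)"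
      unfolding q_def using N by (intro continuous_intros) auto
    then show "continuous_on {0..1} (\<lambda>t. q t x * log 2 (q t x))"
      by (rule continuous_on_compose2[OF continuous_on_x_log_x]) (use q_nonneg in auto)
  qed
  moreover have "H 0 = 0"
    by (auto simp: H_def q_def intro!: sum.neutral)
  moreover have "H 1 = log 2 N"
    using N by (simp add: H_def q_def log_divide)
  ultimately obtain t where "t \<in> {0..1}" "H t = h"
    using h IVT'[of H 0 h 1] by auto
  then show ?thesis
    using q_nonneg q_sum unfolding H_def by (intro exI[of _ "q t"]) auto
qed

section \<open>Entropy under relabelling and independence\<close>

context information_space
begin

text \<open>Entropy sees only the partition of the sample space into level sets. Variables with
  equal partitions differ by an injective relabelling \<open>f\<close> of the values.\<close>

lemma entropy_cong_kernel:
  assumes X: "simple_function M X"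
    and eq: "\<And>x y. x \<in> space M \<Longrightarrow> y \<in> space M \<Longrightarrow> X x = X y \<longleftrightarrow> Y x = Y y"
  shows "\<H>(X) = \<H>(Y)"
proof -
  define f where "f v = Y (inv_into (space M) X v)" for v
  have fX: "f (X x) = Y x" if "x \<in> space M" for x
    using eq[OF inv_into_into[of "X x" X "space M"] that] that f_inv_into_f[of "X x" X "space M"]
    by (auto simp: f_def)
  have inj: "inj_on f (X ` space M)"
    by (auto simp: inj_on_def fX eq)
  have Y: "simple_function M Y"
  proof -
    have "simple_function M (f \<circ> X)"
      using X by auto
    then show ?thesis
      by (subst simple_function_cong[of _ _ "f \<circ> X"]) (auto simp: fX)
  qed
  have "\<H>(X) = \<H>(f \<circ> X)"
    using entropy_of_inj[OF X inj] by simp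
  \<comment> \<open>The two functions are known to agree only on \<open>space M\<close>, so their
    entropies are compared through a common mass function.\<close>
  also have "\<dots> = \<H>(Y)"
  proof -
    have img: "(f \<circ> X) ` space M = Y ` space M"
      by (auto simp: fX image_iff)
    have "(f \<circ> X) -` {v} \<inter> space M = Y -` {v} \<inter> space M" for v
      by (auto simp: fX)
    then have "simple_distributed M (f \<circ> X) (\<lambda>v. prob (Y -` {v} \<inter> space M))"
      using X by (intro simple_distributedI) auto
    from entropy_simple_distributed[OF this]
      entropy_simple_distributed[OF simple_distributedI[OF Y measure_nonneg refl]]
    show ?thesis
      unfolding img by simp
  qed
  finally show ?thesis .
qed

text \<open>Independence makes the mutual information vanish, and mutual information is the drop
  from entropy to conditional entropy.\<close>

lemma conditional_entropy_indep:
  assumes X: "simple_function M X" and Y: "simple_function M Y"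
    and indep: "\<And>x y. x \<in> X ` space M \<Longrightarrow> y \<in> Y ` space M \<Longrightarrow>
      prob {\<omega>\<in>space M. X \<omega> = x \<and> Y \<omega> = y} =
        prob {\<omega>\<in>space M. X \<omega> = x} * prob {\<omega>\<in>space M. Y \<omega> = y}"
  shows "\<H>(X | Y) = \<H>(X)"
proof -
  note dist = simple_distributedI[OF _ measure_nonneg refl]
  have "\<I>(X ; Y) = 0"
  proof (rule mutual_information_eq_0_simple[OF dist[OF X] dist[OF Y] dist[OF simple_function_Pair[OF X Y]]])
    show "\<forall>x\<in>space M. prob ((\<lambda>x. (X x, Y x)) -` {(X x, Y x)} \<inter> space M) =
        prob (X -` {X x} \<inter> space M) * prob (Y -` {Y x} \<inter> space M)"
    proof
      fix x assume "x \<in> space M"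
      moreover have "(\<lambda>x. (X x, Y x)) -` {(X x, Y x)} \<inter> space M = {\<omega>\<in>space M. X \<omega> = X x \<and> Y \<omega> = Y x}"
        "X -` {X x} \<inter> space M = {\<omega>\<in>space M. X \<omega> = X x}"
        "Y -` {Y x} \<inter> space M = {\<omega>\<in>space M. Y \<omega> = Y x}"
        by auto
      ultimately show "prob ((\<lambda>x. (X x, Y x)) -` {(X x, Y x)} \<inter> space M) =
        prob (X -` {X x} \<inter> space M) * prob (Y -` {Y x} \<inter> space M)"
        using indep[of "X x" "Y x"] by simp
    qed
  qed
  then show ?thesis
    using mutual_information_eq_entropy_conditional_entropy[OF X Y] by simp
qed

end

section \<open>Independence from shift invariance\<close>

text \<open>The maps \<open>\<phi> d\<close> translate \<open>\<sigma>\<close> while preserving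
  \<open>v\<close> and \<open>T\<close>, so the \<open>v\<close>-mass of the set where
  \<open>T\<close> is \<open>t\<close> is spread evenly over the values of \<open>\<sigma>\<close>.
  Summing over these values identifies the common \<open>v\<close>-mass of the fibres with the
  \<open>w\<close>-mass of that set, because \<open>p\<close> has total 1.\<close>

lemma shift_independence:
  fixes w v :: "'a \<Rightarrow> real" and \<sigma> :: "'a \<Rightarrow> int" and \<phi> :: "int \<Rightarrow> 'a \<Rightarrow> 'a"
  assumes fin: "finite \<Omega>" and s: "s \<in> {0..<N}"
    and w: "\<And>\<omega>. \<omega> \<in> \<Omega> \<Longrightarrow> w \<omega> = p (\<sigma> \<omega>) * v \<omega>"
    and p: "(\<Sum>x\<in>{0..<N}. p x) = 1"
    and \<sigma>: "\<And>\<omega>. \<omega> \<in> \<Omega> \<Longrightarrow> \<sigma> \<omega> \<in> {0..<N}"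
    and \<phi>: "\<And>d \<omega>. \<omega> \<in> \<Omega> \<Longrightarrow> \<phi> d \<omega> \<in> \<Omega>" "\<And>d \<omega>. \<omega> \<in> \<Omega> \<Longrightarrow> \<phi> (- d) (\<phi> d \<omega>) = \<omega>"
      "\<And>d \<omega>. \<omega> \<in> \<Omega> \<Longrightarrow> \<sigma> (\<phi> d \<omega>) = (\<sigma> \<omega> + d) mod N"
      "\<And>d \<omega>. \<omega> \<in> \<Omega> \<Longrightarrow> v (\<phi> d \<omega>) = v \<omega>" "\<And>d \<omega>. \<omega> \<in> \<Omega> \<Longrightarrow> T (\<phi> d \<omega>) = T \<omega>"
  shows "(\<Sum>\<omega> | \<omega> \<in> \<Omega> \<and> \<sigma> \<omega> = s \<and> T \<omega> = t. w \<omega>) = p s * (\<Sum>\<omega> | \<omega> \<in> \<Omega> \<and> T \<omega> = t. w \<omega>)"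
proof -
  define D where "D s = (\<Sum>\<omega> | \<omega> \<in> \<Omega> \<and> \<sigma> \<omega> = s \<and> T \<omega> = t. v \<omega>)" for s
  \<comment> \<open>The translation by \<open>- s\<close> carries the fibre over \<open>s\<close>
    onto the fibre over 0.\<close>
  have D: "D s = D 0" if "s \<in> {0..<N}" for s
    unfolding D_def
    by (rule sum.reindex_bij_witness[where i = "\<phi> s" and j = "\<phi> (- s)"])
      (use that \<phi> \<phi>(2)[of _ "- s"] in \<open>auto simp: mod_simps\<close>)
  have joint: "(\<Sum>\<omega> | \<omega> \<in> \<Omega> \<and> \<sigma> \<omega> = s \<and> T \<omega> = t. w \<omega>) = p s * D 0" if "s \<in> {0..<N}" for s
    unfolding D[OF that, symmetric] unfolding D_def sum_distrib_left by (rule sum.cong) (auto simp: w)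
  have "(\<Sum>\<omega> | \<omega> \<in> \<Omega> \<and> T \<omega> = t. w \<omega>) =
      (\<Sum>s\<in>{0..<N}. \<Sum>\<omega> | \<omega> \<in> {\<omega> \<in> \<Omega>. T \<omega> = t} \<and> \<sigma> \<omega> = s. w \<omega>)"
    by (rule sum.group[symmetric]) (use fin \<sigma> in auto)
  also have "\<dots> = (\<Sum>s\<in>{0..<N}. p s * D 0)"
  proof (rule sum.cong)
    fix s assume "s \<in> {0..<N}"
    moreover have "{\<omega> \<in> {\<omega> \<in> \<Omega>. T \<omega> = t}. \<sigma> \<omega> = s} = {\<omega> \<in> \<Omega>. \<sigma> \<omega> = s \<and> T \<omega> = t}"
      by auto
    ultimately show "(\<Sum>\<omega> | \<omega> \<in> {\<omega> \<in> \<Omega>. T \<omega> = t} \<and> \<sigma> \<omega> = s. w \<omega>) = p s * D 0"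
      using joint by simp
  qed simp
  also have "\<dots> = D 0"
    using p by (simp flip: sum_distrib_right)
  finally show ?thesis
    using joint[OF s] by simp
qed

lemma tuple_rv_eq_iff:
  assumes "finite A"
  shows "tuple_rv X A x = tuple_rv Y A y \<longleftrightarrow> (\<forall>i\<in>A. X i x = Y i y)"
  using assms by (auto simp: tuple_rv_def)


section \<open>Uniqueness of Moebius inverses\<close>

text \<open>By induction on the number of antichains below \<open>\<alpha>\<close>, all terms
  strictly below \<open>\<alpha>\<close> vanish, so the sum reduces to
  \<open>g \<alpha>\<close>.\<close>

lemma antichain_sums_eq_0D:
  fixes g :: "nat set set \<Rightarrow> real"
  assumes sums: "\<And>\<alpha>. antichain n \<alpha> \<Longrightarrow> (\<Sum>\<beta> | antichain n \<beta> \<and> \<beta> \<preceq> \<alpha>. g \<beta>) = 0"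
    and "antichain n \<alpha>"
  shows "g \<alpha> = 0"
  using assms(2)
proof (induction "card {\<beta>. antichain n \<beta> \<and> \<beta> \<preceq> \<alpha>}" arbitrary: \<alpha> rule: less_induct)
  case less
  let ?D = "\<lambda>\<alpha>. {\<beta>. antichain n \<beta> \<and> \<beta> \<preceq> \<alpha>}"
  have fin: "finite (?D \<alpha>)"
    by (rule finite_subset[OF _ finite_antichains[of n]]) blast
  have \<alpha>: "\<alpha> \<in> ?D \<alpha>"
    using less.prems antichain_le_refl by simp
  have "g \<beta> = 0" if \<beta>: "\<beta> \<in> ?D \<alpha> - {\<alpha>}" for \<beta>
  proof (rule less.hyps)
    have "?D \<beta> \<subseteq> ?D \<alpha>"
      using \<beta> antichain_le_trans by blast
    moreover have "\<alpha> \<notin> ?D \<beta>"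
      using \<beta> less.prems antichain_le_antisym by blast
    ultimately show "card (?D \<beta>) < card (?D \<alpha>)"
      using \<alpha> by (intro psubset_card_mono[OF fin] psubsetI) force+
    show "antichain n \<beta>"
      using \<beta> by simp
  qed
  then have "sum g (?D \<alpha> - {\<alpha>}) = 0"
    by (rule sum.neutral[OF ballI])
  then show "g \<alpha> = 0"
    using sum.remove[OF fin \<alpha>, of g] sums[OF less.prems] by linarith
qed

text \<open>Exhibiting one Moebius inverse settles the definite description: its difference to any
  other one has vanishing sums below every antichain, and both are 0 elsewhere.\<close>

lemma partial_information_eqI:
  assumes "moebius_inverse I n M S X f"
  shows "partial_information I n M S X = f"
  unfolding partial_information_def
proof (rule the_equality)
  show "moebius_inverse I n M S X f"
    by (rule assms)
next
  fix f' assume f': "moebius_inverse I n M S X f'"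
  have "f' \<alpha> - f \<alpha> = 0" if "antichain n \<alpha>" for \<alpha>
  proof (rule antichain_sums_eq_0D[where g = "\<lambda>\<alpha>. f' \<alpha> - f \<alpha>", OF _ that])
    fix \<alpha> assume \<alpha>: "antichain n \<alpha>"
    then have "finite \<alpha>"
      by (intro finite_subset[of \<alpha> "Pow {1..n}"]) (auto simp: antichain_def)
    then obtain As where As: "distinct As" "set As = \<alpha>"
      using finite_distinct_list by blast
    have "(\<Sum>\<beta> | antichain n \<beta> \<and> \<beta> \<preceq> set As. f' \<beta>) = (\<Sum>\<beta> | antichain n \<beta> \<and> \<beta> \<preceq> set As. f \<beta>)"
      using assms f' As \<alpha> unfolding moebius_inverse_def by metis
    then show "(\<Sum>\<beta> | antichain n \<beta> \<and> \<beta> \<preceq> \<alpha>. f' \<beta> - f \<beta>) = 0"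
      unfolding As(2) sum_subtractf by simp
  qed
  moreover have "f' \<alpha> = f \<alpha>" if "\<not> antichain n \<alpha>" for \<alpha>
    using assms f' that unfolding moebius_inverse_def by metis
  ultimately show "f' = f"
    by (intro ext) (metis eq_iff_diff_eq_0)
qed

section \<open>The sharing scheme and its sample space\<close>

text \<open>The access structure generated by \<open>\<beta>\<close>. A family of subsets of
  \<open>{1..n}\<close> lies inside it exactly when \<open>\<beta>\<close> precedes the family in
  \<open>\<preceq>\<close>, which links authorization to the order on antichains.\<close>

definition upward_closure :: "nat \<Rightarrow> nat set set \<Rightarrow> nat set set" where
  "upward_closure n \<beta> = {A. A \<subseteq> {1..n} \<and> (\<exists>B\<in>\<beta>. B \<subseteq> A)}"

text \<open>The measure has to live on the given type \<open>'w\<close>, whereas the natural sample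
  points are functions on keys; \<open>dec\<close> identifies the points of \<open>W\<close> with
  these functions. The law of the \<open>j\<close>-th secret is \<open>p j\<close>, and one modulus
  \<open>N\<close> serves all secrets.\<close>

locale independent_sharing =
  fixes n l :: nat and N :: int and \<alpha> :: "nat \<Rightarrow> nat set set" and p :: "nat \<Rightarrow> int \<Rightarrow> real"
    and W :: "'w set" and dec :: "'w \<Rightarrow> nat \<times> nat set \<times> nat \<Rightarrow> int"
  assumes N_pos: "0 < N"
    and antichain: "j \<in> {1..l} \<Longrightarrow> antichain n (\<alpha> j)"
    and p_nonneg: "j \<in> {1..l} \<Longrightarrow> 0 \<le> p j x"
    and p_sum: "j \<in> {1..l} \<Longrightarrow> (\<Sum>x\<in>{0..<N}. p j x) = 1"
    and dec: "bij_betw dec W (({1..l} \<times> Pow {1..n} \<times> {..n}) \<rightarrow>\<^sub>E {0..<N})"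
begin

text \<open>
  A sample point assigns a number modulo \<open>N\<close> to every key. The key \<open>(j, {}, 0)\<close> holds the \<open>j\<close>-th
  secret, and \<open>(j, B, i)\<close> with \<open>i \<in> B \<in> \<alpha> j\<close> the share of \<open>i\<close> in the distribution of that secret over
  \<open>B\<close>. The remaining keys are padding that makes \<open>keys\<close> a plain product.
\<close>

definition keys :: "(nat \<times> nat set \<times> nat) set" where
  "keys = {1..l} \<times> Pow {1..n} \<times> {..n}"

definition \<Omega> :: "(nat \<times> nat set \<times> nat \<Rightarrow> int) set" where
  "\<Omega> = keys \<rightarrow>\<^sub>E {0..<N}"

definition key :: "nat \<Rightarrow> nat \<times> nat set \<times> nat" where
  "key j = (j, {}, 0)"

text \<open>The law of the coordinate at \<open>k\<close>: secrets follow \<open>p\<close>, shares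
  are uniform. Padding keys \<open>(j, {}, i)\<close> with \<open>i > 0\<close> get
  \<open>p j\<close> too, so every coordinate carries a probability distribution.\<close>

definition q :: "nat \<times> nat set \<times> nat \<Rightarrow> int \<Rightarrow> real" where
  "q k x = (if fst (snd k) = {} then p (fst k) x else 1 / N)"

definition weight :: "(nat \<times> nat set \<times> nat \<Rightarrow> int) \<Rightarrow> real" where
  "weight \<omega> = (\<Prod>k\<in>keys. q k (\<omega> k))"

definition M :: "'w measure" where
  "M = point_measure W (\<lambda>x. ennreal (weight (dec x)))"

text \<open>Every party, even one outside of \<open>B\<close>, also receives the public correction for \<open>B\<close>.\<close>

definition share ::
  "nat \<Rightarrow> (nat \<times> nat set \<times> nat \<Rightarrow> int) \<Rightarrow> (nat \<times> nat set \<Rightarrow> int) \<times> (nat \<times> nat set \<Rightarrow> int)"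
  where "share i \<omega> =
    ((\<lambda>(j, B). if j \<in> {1..l} \<and> B \<in> \<alpha> j then (\<omega> (key j) - (\<Sum>x\<in>B. \<omega> (j, B, x))) mod N else 0),
     (\<lambda>(j, B). if j \<in> {1..l} \<and> B \<in> \<alpha> j \<and> i \<in> B then \<omega> (j, B, i) else 0))"

definition secret_rv :: "nat \<Rightarrow> (nat \<times> nat set \<times> nat \<Rightarrow> int) \<Rightarrow> val" where
  "secret_rv j \<omega> = Atom (nat (\<omega> (key j)))"

text \<open>A share is a pair of functions, but the atoms of \<open>val\<close> are natural numbers.
  The possible shares are therefore numbered, injectively because there are only finitely
  many.\<close>

definition share_rv :: "nat \<Rightarrow> (nat \<times> nat set \<times> nat \<Rightarrow> int) \<Rightarrow> val" where
  "share_rv i \<omega> = Atom (to_nat_on (share i ` \<Omega>) (share i \<omega>))"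

definition S :: "nat \<Rightarrow> 'w \<Rightarrow> val" where
  "S j x = secret_rv j (dec x)"

definition X :: "nat \<Rightarrow> 'w \<Rightarrow> val" where
  "X i x = share_rv i (dec x)"

text \<open>The translations fed to \<open>shift_independence\<close>. For \<open>J\<close> inside
  \<open>keys\<close>, reduction modulo \<open>N\<close> keeps \<open>\<Omega>\<close> invariant,
  and shifting by \<open>- d\<close> undoes shifting by \<open>d\<close> on it.\<close>

definition shift ::
  "(nat \<times> nat set \<times> nat) set \<Rightarrow> int \<Rightarrow> (nat \<times> nat set \<times> nat \<Rightarrow> int) \<Rightarrow>
    nat \<times> nat set \<times> nat \<Rightarrow> int"
  where "shift J d \<omega> = (\<lambda>k. if k \<in> J then (\<omega> k + d) mod N else \<omega> k)"

lemma finite_keys: "finite keys"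
  by (simp add: keys_def)

lemma finite_\<Omega>: "finite \<Omega>"
  by (auto simp: \<Omega>_def intro!: finite_PiE finite_keys)

lemma dec_\<Omega>: "bij_betw dec W \<Omega>"
  using dec by (simp add: \<Omega>_def keys_def)

lemma finite_W: "finite W"
  using bij_betw_finite[OF dec_\<Omega>] finite_\<Omega> by simp

lemma dec_in: "x \<in> W \<Longrightarrow> dec x \<in> \<Omega>"
  using dec_\<Omega> by (auto simp: bij_betw_def)

lemma key_in: "j \<in> {1..l} \<Longrightarrow> key j \<in> keys"
  by (simp add: key_def keys_def)

lemma \<Omega>_range: "\<omega> \<in> \<Omega> \<Longrightarrow> k \<in> keys \<Longrightarrow> \<omega> k \<in> {0..<N}"
  unfolding \<Omega>_def by (rule PiE_mem)

lemma antichainD: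
  assumes "j \<in> {1..l}" "B \<in> \<alpha> j"
  shows "B \<noteq> {}" "B \<subseteq> {1..n}" "finite B" "x \<in> B \<Longrightarrow> (j, B, x) \<in> keys"
proof -
  show B: "B \<noteq> {}" "B \<subseteq> {1..n}"
    using antichain[OF assms(1)] assms(2) by (auto simp: antichain_def)
  then show "finite B"
    by (auto intro: finite_subset)
  show "x \<in> B \<Longrightarrow> (j, B, x) \<in> keys"
    using assms B by (auto simp: keys_def)
qed

lemma q_nonneg: "k \<in> keys \<Longrightarrow> 0 \<le> q k x"
  using p_nonneg N_pos by (auto simp: q_def keys_def)

lemma weight_nonneg: "0 \<le> weight \<omega>"
  unfolding weight_def by (intro prod_nonneg) (auto intro: q_nonneg)

lemma sum_weight: "(\<Sum>\<omega>\<in>\<Omega>. weight \<omega>) = 1"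
proof -
  have "(\<Sum>\<omega>\<in>\<Omega>. weight \<omega>) = (\<Prod>k\<in>keys. \<Sum>x\<in>{0..<N}. q k x)"
    unfolding weight_def \<Omega>_def by (rule prod_sum_PiE[symmetric]) (auto simp: finite_keys)
  also have "\<dots> = 1"
  proof (intro prod.neutral ballI)
    fix k assume "k \<in> keys"
    then show "(\<Sum>x\<in>{0..<N}. q k x) = 1"
      using p_sum[of "fst k"] N_pos by (cases "fst (snd k) = {}") (auto simp: q_def keys_def)
  qed
  finally show ?thesis .
qed

lemma space_M [simp]: "space M = W"
  by (simp add: M_def space_point_measure)

lemma simple_function_M [simp]: "simple_function M f"
  using finite_W by (simp add: M_def)

lemma measure_M:
  "measure M {x \<in> space M. P (dec x)} = (\<Sum>\<omega> | \<omega> \<in> \<Omega> \<and> P \<omega>. weight \<omega>)"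
proof -
  have "measure M {x \<in> space M. P (dec x)} = (\<Sum>x | x \<in> W \<and> P (dec x). weight (dec x))"
    unfolding space_M unfolding M_def
    by (subst measure_point_measure_finite_if) (auto simp: finite_W weight_nonneg)
  also have "\<dots> = (\<Sum>\<omega> | \<omega> \<in> \<Omega> \<and> P \<omega>. weight \<omega>)"
    using dec_\<Omega> by (intro sum.reindex_bij_betw) (auto simp: bij_betw_def inj_on_def)
  finally show ?thesis .
qed

lemma prob_space_M: "prob_space M"
proof -
  have "(\<Sum>x\<in>W. weight (dec x)) = 1"
    using sum.reindex_bij_betw[OF dec_\<Omega>, of weight] sum_weight by simp
  then have "(\<Sum>x\<in>W. ennreal (weight (dec x))) = 1"
    by (simp add: weight_nonneg)
  then show ?thesis
    unfolding M_def using finite_W by (intro prob_space_point_measure) auto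
qed

lemma information_space_M: "information_space M 2"
  using prob_space_M by (intro information_space.intro information_space_axioms.intro) auto

section \<open>The law of a secret and shift-invariant observations\<close>

text \<open>Besides the secret, the shift moves only coordinates with the constant factor
  \<open>1 / N\<close>. The weight thus splits into the law of the secret and an invariant product,
  as \<open>shift_independence\<close> demands.\<close>

lemma sum_weight_shift_invariant:
  assumes j: "j \<in> {1..l}" and s: "s \<in> {0..<N}" and J: "J \<subseteq> keys" "key j \<in> J"
    and J_secret: "\<And>k. k \<in> J \<Longrightarrow> fst (snd k) = {} \<Longrightarrow> k = key j"
    and T: "\<And>d \<omega>. \<omega> \<in> \<Omega> \<Longrightarrow> T (shift J d \<omega>) = T \<omega>"
  shows "(\<Sum>\<omega> | \<omega> \<in> \<Omega> \<and> \<omega> (key j) = s \<and> T \<omega> = t. weight \<omega>) =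
    p j s * (\<Sum>\<omega> | \<omega> \<in> \<Omega> \<and> T \<omega> = t. weight \<omega>)"
proof (rule shift_independence[where \<phi> = "shift J" and v = "\<lambda>\<omega>. \<Prod>k\<in>keys - {key j}. q k (\<omega> k)"])
  show "weight \<omega> = p j (\<omega> (key j)) * (\<Prod>k\<in>keys - {key j}. q k (\<omega> k))" for \<omega>
    unfolding weight_def
    by (subst prod.remove[OF finite_keys key_in[OF j]]) (simp add: q_def key_def)
  show "shift J d \<omega> \<in> \<Omega>" if "\<omega> \<in> \<Omega>" for d \<omega>
    using that J(1) N_pos by (auto simp: \<Omega>_def shift_def PiE_iff extensional_def)
  show "shift J (- d) (shift J d \<omega>) = \<omega>" if "\<omega> \<in> \<Omega>" for d \<omega>
    using \<Omega>_range[OF that] J(1) by (auto simp: shift_def mod_simps fun_eq_iff subset_iff)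
  show "shift J d \<omega> (key j) = (\<omega> (key j) + d) mod N" for d \<omega>
    using J by (simp add: shift_def)
  show "(\<Prod>k\<in>keys - {key j}. q k (shift J d \<omega> k)) = (\<Prod>k\<in>keys - {key j}. q k (\<omega> k))" for d \<omega>
    using J_secret by (intro prod.cong) (auto simp: shift_def q_def)
  show "\<omega> (key j) \<in> {0..<N}" if "\<omega> \<in> \<Omega>" for \<omega>
    using \<Omega>_range[OF that key_in[OF j]] .
qed (use finite_\<Omega> s p_sum[OF j] T in auto)

lemma prob_secret:
  assumes j: "j \<in> {1..l}" and s: "s \<in> {0..<N}"
  shows "measure M {x \<in> space M. S j x = Atom (nat s)} = p j s"
proof -
  have "measure M {x \<in> space M. S j x = Atom (nat s)} = (\<Sum>\<omega> | \<omega> \<in> \<Omega> \<and> \<omega> (key j) = s. weight \<omega>)"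
    unfolding S_def secret_rv_def measure_M[of "\<lambda>\<omega>. Atom (nat (\<omega> (key j))) = Atom (nat s)"]
    using s \<Omega>_range[OF _ key_in[OF j]] by (intro sum.cong) (auto simp: eq_nat_nat_iff)
  \<comment> \<open>Shifting the secret alone and taking \<open>T\<close> constant leaves the total
    weight, which is 1, as the second factor.\<close>
  also have "\<dots> = p j s"
    using sum_weight_shift_invariant[OF j s, of "{key j}" "\<lambda>_. ()" "()"] key_in[OF j] sum_weight
    by simp
  finally show ?thesis .
qed

lemma shannon_entropy_chain_rule:
  "shannon_entropy M (\<lambda>x. (Y x, Z x)) = shannon_entropy M Y + cond_shannon_entropy M Z Y"
  unfolding shannon_entropy_def cond_shannon_entropy_def
  by (rule information_space.entropy_chain_rule[OF information_space_M]) auto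

lemma shannon_entropy_cong_kernel:
  assumes "\<And>x y. x \<in> W \<Longrightarrow> y \<in> W \<Longrightarrow> Y x = Y y \<longleftrightarrow> Z x = Z y"
  shows "shannon_entropy M Y = shannon_entropy M Z"
  unfolding shannon_entropy_def by (rule information_space.entropy_cong_kernel[OF information_space_M]) (use assms in auto)

text \<open>What a shift of the secret leaves unchanged is independent of the secret, since
  \<open>sum_weight_shift_invariant\<close> factors the joint probabilities.\<close>

lemma conditional_entropy_secret:
  assumes j: "j \<in> {1..l}" and J: "J \<subseteq> keys" "key j \<in> J"
    and J_secret: "\<And>k. k \<in> J \<Longrightarrow> fst (snd k) = {} \<Longrightarrow> k = key j"
    and T: "\<And>d \<omega>. \<omega> \<in> \<Omega> \<Longrightarrow> T (shift J d \<omega>) = T \<omega>"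
  shows "cond_shannon_entropy M (S j) (\<lambda>x. T (dec x)) = shannon_entropy M (S j)"
unfolding shannon_entropy_def cond_shannon_entropy_def
proof (rule information_space.conditional_entropy_indep[OF information_space_M])
  fix v t assume "v \<in> S j ` space M"
  then obtain x where x: "x \<in> W" "v = S j x"
    by auto
  define s where "s = dec x (key j)"
  have s: "s \<in> {0..<N}"
    using \<Omega>_range[OF dec_in[OF x(1)] key_in[OF j]] by (simp add: s_def)
  have v: "v = Atom (nat s)"
    by (simp add: x S_def secret_rv_def s_def)
  have "measure M {x \<in> space M. S j x = v \<and> T (dec x) = t} =
      (\<Sum>\<omega> | \<omega> \<in> \<Omega> \<and> \<omega> (key j) = s \<and> T \<omega> = t. weight \<omega>)"
    unfolding S_def secret_rv_def v measure_M[of "\<lambda>\<omega>. Atom (nat (\<omega> (key j))) = Atom (nat s) \<and> T \<omega> = t"]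
    using s \<Omega>_range[OF _ key_in[OF j]] by (intro sum.cong) (auto simp: eq_nat_nat_iff)
  also have "\<dots> = p j s * (\<Sum>\<omega> | \<omega> \<in> \<Omega> \<and> T \<omega> = t. weight \<omega>)"
    by (rule sum_weight_shift_invariant) (use assms s in auto)
  also have "\<dots> = measure M {x \<in> space M. S j x = v} * measure M {x \<in> space M. T (dec x) = t}"
    unfolding v prob_secret[OF j s] measure_M[of "\<lambda>\<omega>. T \<omega> = t"] by simp
  finally show "measure M {x \<in> space M. S j x = v \<and> T (dec x) = t} =
      measure M {x \<in> space M. S j x = v} * measure M {x \<in> space M. T (dec x) = t}" .
qed auto

lemma entropy_secret:
  assumes j: "j \<in> {1..l}"
  shows "shannon_entropy M (S j) = - (\<Sum>s\<in>{0..<N}. p j s * log 2 (p j s))"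
proof -
  have img: "S j ` space M = (\<lambda>s. Atom (nat s)) ` {0..<N}"
  proof (intro equalityI subsetI)
    fix v assume "v \<in> S j ` space M"
    then show "v \<in> (\<lambda>s. Atom (nat s)) ` {0..<N}"
      using \<Omega>_range[OF dec_in key_in[OF j]] by (auto simp: S_def secret_rv_def)
  next
    fix v assume "v \<in> (\<lambda>s. Atom (nat s)) ` {0..<N}"
    then obtain s where s: "s \<in> {0..<N}" "v = Atom (nat s)"
      by auto
    \<comment> \<open>The constant assignment shows that \<open>s\<close> occurs as a secret even
      when \<open>p j s\<close> is 0; the image of the sample space is all residues, null points
      included.\<close>
    then have "(\<lambda>k. if k \<in> keys then s else undefined) \<in> \<Omega>"
      by (auto simp: \<Omega>_def)
    then obtain x where "x \<in> W" "dec x = (\<lambda>k. if k \<in> keys then s else undefined)"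
      using dec_\<Omega> by (metis bij_betw_imp_surj_on imageE)
    then show "v \<in> S j ` space M"
      using key_in[OF j] by (intro image_eqI[of _ _ x]) (auto simp: S_def secret_rv_def s)
  qed
  have "shannon_entropy M (S j) = - (\<Sum>v\<in>S j ` space M.
      measure M {x \<in> space M. S j x = v} * log 2 (measure M {x \<in> space M. S j x = v}))"
    unfolding shannon_entropy_def
    by (intro information_space.entropy_simple_distributed[OF information_space_M]
        prob_space.simple_distributedI[OF prob_space_M])
      (auto intro!: arg_cong[where f = "measure M"])
  also have "\<dots> = - (\<Sum>s\<in>{0..<N}. p j s * log 2 (p j s))"
    unfolding img by (subst sum.reindex) (auto simp: inj_on_def eq_nat_nat_iff prob_secret[OF j, unfolded space_M])
  finally show ?thesis .
qed

text \<open>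
  Adding \<open>d\<close> to a secret and, in every minimal authorized set \<open>B\<close>, to the share of one party outside
  of \<open>A\<close> leaves all corrections unchanged, and hence everything that \<open>A\<close> can see.
\<close>

lemma unauthorized_shift:
  assumes j: "j \<in> {1..l}" and A: "A \<subseteq> {1..n}" "A \<notin> upward_closure n (\<alpha> j)"
  obtains J where "J \<subseteq> keys" "key j \<in> J" "\<And>k. k \<in> J \<Longrightarrow> fst (snd k) = {} \<Longrightarrow> k = key j"
    "\<And>d \<omega> j'. j' \<noteq> j \<Longrightarrow> secret_rv j' (shift J d \<omega>) = secret_rv j' \<omega>"
    "\<And>d \<omega> i. i \<in> A \<Longrightarrow> share_rv i (shift J d \<omega>) = share_rv i \<omega>"
proof -
  have "\<forall>B\<in>\<alpha> j. \<exists>b. b \<in> B \<and> b \<notin> A"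
    using A by (auto simp: upward_closure_def)
  then obtain b where b: "\<And>B. B \<in> \<alpha> j \<Longrightarrow> b B \<in> B" "\<And>B. B \<in> \<alpha> j \<Longrightarrow> b B \<notin> A"
    by metis
  define J where "J = insert (key j) ((\<lambda>B. (j, B, b B)) ` \<alpha> j)"
  \<comment> \<open>Members of \<open>\<alpha> j'\<close> are nonempty, so the key of a share never
    coincides with the key of a secret.\<close>
  have J_iff: "(j', B, x) \<in> J \<longleftrightarrow> j' = j \<and> x = b B" if "j' \<in> {1..l}" "B \<in> \<alpha> j'" for j' B x
    using that antichainD(1)[OF that] by (auto simp: J_def key_def)
  have key_iff: "key j' \<in> J \<longleftrightarrow> j' = j" for j'
    using antichainD(1)[OF j] by (auto simp: J_def key_def)
  show thesis
  proof (rule that[of J])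
    show "J \<subseteq> keys"
      using key_in[OF j] antichainD(4)[OF j] b by (auto simp: J_def)
    show "key j \<in> J"
      by (simp add: J_def)
    show "k = key j" if "k \<in> J" "fst (snd k) = {}" for k
      using that antichainD(1)[OF j] by (auto simp: J_def)
    show "secret_rv j' (shift J d \<omega>) = secret_rv j' \<omega>" if "j' \<noteq> j" for d \<omega> j'
      using that by (simp add: secret_rv_def shift_def key_iff)
    show "share_rv i (shift J d \<omega>) = share_rv i \<omega>" if "i \<in> A" for d \<omega> i
    proof -
      have "(shift J d \<omega> (key j') - (\<Sum>x\<in>B. shift J d \<omega> (j', B, x))) mod N =
          (\<omega> (key j') - (\<Sum>x\<in>B. \<omega> (j', B, x))) mod N" if B: "j' \<in> {1..l}" "B \<in> \<alpha> j'" for j' B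
      proof (cases "j' = j")
        case False
        then show ?thesis
          by (simp add: shift_def key_iff J_iff[OF B])
      next
        case True
        have bB: "b B \<in> B" "finite B"
          using b B True antichainD(3)[OF B] by auto
        have "(\<Sum>x\<in>B - {b B}. shift J d \<omega> (j', B, x)) = (\<Sum>x\<in>B - {b B}. \<omega> (j', B, x))"
          by (rule sum.cong) (auto simp: shift_def J_iff[OF B])
        then have "(\<Sum>x\<in>B. shift J d \<omega> (j', B, x)) =
            (\<omega> (j', B, b B) + d) mod N + (\<Sum>x\<in>B - {b B}. \<omega> (j', B, x))"
          using J_iff[OF B, of "b B"] True by (subst sum.remove[OF bB(2,1)]) (simp add: shift_def)
        moreover have "(\<Sum>x\<in>B. \<omega> (j', B, x)) = \<omega> (j', B, b B) + (\<Sum>x\<in>B - {b B}. \<omega> (j', B, x))"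
          by (rule sum.remove[OF bB(2,1)])
        moreover have "shift J d \<omega> (key j') = (\<omega> (key j') + d) mod N"
          using True by (simp add: shift_def key_iff)
        \<comment> \<open>The increments of the secret and of the moved share cancel, although each
          is reduced modulo \<open>N\<close> separately.\<close>
        moreover have "((a + d) mod N - ((c + d) mod N + e)) mod N = (a - (c + e)) mod N" for a c e
        proof -
          have "((a + d) mod N - ((c + d) mod N + e)) mod N = ((a + d) - ((c + d) + e)) mod N"
            by (intro mod_diff_cong) (simp_all add: mod_simps)
          then show ?thesis
            by (simp add: algebra_simps)
        qed
        ultimately show ?thesis
          by simp
      qed
      moreover have "shift J d \<omega> (j', B, i) = \<omega> (j', B, i)" if B: "j' \<in> {1..l}" "B \<in> \<alpha> j'" for j' B
        using b(2)[of B] B \<open>i \<in> A\<close> by (auto simp: shift_def J_iff[OF B])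
      ultimately have "share i (shift J d \<omega>) = share i \<omega>"
        by (auto simp: share_def fun_eq_iff)
      then show ?thesis
        by (simp add: share_rv_def)
    qed
  qed
qed

section \<open>Secrecy, reconstruction and the combined scheme\<close>

lemma tuple_rv_dec: "tuple_rv S J x = tuple_rv secret_rv J (dec x)"
  "tuple_rv X A x = tuple_rv share_rv A (dec x)"
  by (simp_all add: tuple_rv_def S_def X_def)

text \<open>The shift chosen for \<open>A\<close> changes neither the shares of \<open>A\<close> nor
  the other secrets, so anything computed from them is independent of the \<open>j\<close>-th
  secret. The function \<open>f\<close> selects what is conditioned on: secrets only, shares only,
  or both.\<close>

lemma conditional_entropy_unauthorized:
  assumes j: "j \<in> {1..l}" and A: "A \<subseteq> {1..n}" "A \<notin> upward_closure n (\<alpha> j)" and R: "finite R" "j \<notin> R"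
  shows "cond_shannon_entropy M (S j) (\<lambda>x. f (tuple_rv S R x, tuple_rv X A x)) = shannon_entropy M (S j)"
proof -
  obtain J where J: "J \<subseteq> keys" "key j \<in> J" "\<And>k. k \<in> J \<Longrightarrow> fst (snd k) = {} \<Longrightarrow> k = key j"
    and inv: "\<And>d \<omega> j'. j' \<noteq> j \<Longrightarrow> secret_rv j' (shift J d \<omega>) = secret_rv j' \<omega>"
    "\<And>d \<omega> i. i \<in> A \<Longrightarrow> share_rv i (shift J d \<omega>) = share_rv i \<omega>"
    using unauthorized_shift[OF j A] by metis
  have "tuple_rv secret_rv R (shift J d \<omega>) = tuple_rv secret_rv R \<omega>" for d \<omega>
    using R inv(1) by (subst tuple_rv_eq_iff) metis+
  moreover have "tuple_rv share_rv A (shift J d \<omega>) = tuple_rv share_rv A \<omega>" for d \<omega>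
    using finite_subset[OF A(1)] inv(2) by (subst tuple_rv_eq_iff) auto
  ultimately show ?thesis
    unfolding tuple_rv_dec by (intro conditional_entropy_secret[OF j J]) auto
qed

text \<open>The parties of a minimal authorized \<open>B\<close> inside \<open>A\<close> know all
  shares over \<open>B\<close> and the public correction. Together these give the secret modulo
  \<open>N\<close>, and the secret lies in \<open>{0..<N}\<close>.\<close>

lemma authorized_determines_secret:
  assumes j: "j \<in> {1..l}" and A: "A \<in> upward_closure n (\<alpha> j)" and xy: "x \<in> W" "y \<in> W"
    and eq: "tuple_rv X A x = tuple_rv X A y"
  shows "S j x = S j y"
proof -
  obtain B where B: "B \<in> \<alpha> j" "B \<subseteq> A" and An: "A \<subseteq> {1..n}"
    using A by (auto simp: upward_closure_def)
  have share: "share i (dec x) = share i (dec y)" if "i \<in> B" for i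
  proof -
    have "X i x = X i y"
      using eq B that finite_subset[OF An] by (simp add: tuple_rv_eq_iff) blast
    then show ?thesis
      using inj_onD[OF inj_on_to_nat_on[of "share i ` \<Omega>"], of "share i (dec x)" "share i (dec y)"]
        finite_\<Omega> dec_in xy
      by (simp add: X_def share_rv_def countable_finite)
  qed
  have "dec x (j, B, i) = dec y (j, B, i)" if "i \<in> B" for i
    using fun_cong[OF arg_cong[OF share[OF that], of snd], of "(j, B)"] B j that
    by (simp add: share_def)
  then have sum: "(\<Sum>i\<in>B. dec x (j, B, i)) = (\<Sum>i\<in>B. dec y (j, B, i))"
    by (rule sum.cong[OF refl])
  \<comment> \<open>The public correction is read off from the share of any one party of
    \<open>B\<close>.\<close>
  obtain i where "i \<in> B"
    using antichainD(1)[OF j B(1)] by auto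
  from fun_cong[OF arg_cong[OF share[OF this], of fst], of "(j, B)"]
  have "(dec x (key j) - (\<Sum>i\<in>B. dec y (j, B, i))) mod N =
      (dec y (key j) - (\<Sum>i\<in>B. dec y (j, B, i))) mod N"
    using B j by (simp add: share_def sum)
  then have "dec x (key j) mod N = dec y (key j) mod N"
    by (simp add: mod_eq_dvd_iff)
  then have "dec x (key j) = dec y (key j)"
    using \<Omega>_range[OF dec_in key_in[OF j]] xy by simp
  then show ?thesis
    by (simp add: S_def secret_rv_def)
qed

lemma empty_unauthorized: "j \<in> {1..l} \<Longrightarrow> {} \<notin> upward_closure n (\<alpha> j)"
  using antichainD(1) by (auto simp: upward_closure_def)

text \<open>The empty set of parties is unauthorized, so secrecy makes each secret independent of
  the others, and the chain rule adds their entropies one at a time.\<close>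

lemma entropy_tuple_secrets:
  assumes "R \<subseteq> {1..l}"
  shows "shannon_entropy M (tuple_rv S R) = (\<Sum>j\<in>R. shannon_entropy M (S j))"
proof -
  have "finite R"
    using assms by (rule finite_subset) simp
  then show ?thesis
    using assms
  proof (induction R)
    case empty
    have "simple_distributed M (tuple_rv S {}) (\<lambda>_. 1)"
      by (rule prob_space.simple_distributedI[OF prob_space_M])
        (auto simp: tuple_rv_def prob_space.prob_space[OF prob_space_M, unfolded space_M])
    from information_space.entropy_simple_distributed[OF information_space_M this] show ?case
      by (simp add: shannon_entropy_def)
  next
    case (insert j R)
    have "shannon_entropy M (tuple_rv S (insert j R)) = shannon_entropy M (\<lambda>x. (tuple_rv S R x, S j x))"
      using insert.hyps by (intro shannon_entropy_cong_kernel) (auto simp: tuple_rv_eq_iff)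
    also have "\<dots> = shannon_entropy M (tuple_rv S R) + cond_shannon_entropy M (S j) (tuple_rv S R)"
      by (rule shannon_entropy_chain_rule)
    also have "cond_shannon_entropy M (S j) (tuple_rv S R) = shannon_entropy M (S j)"
      using conditional_entropy_unauthorized[of j "{}" R fst] empty_unauthorized[of j] insert
      by simp
    finally show ?case
      using insert by simp
  qed
qed

lemma combined_secret_sharing_M:
  "combined_secret_sharing n l (\<lambda>j. upward_closure n (\<alpha> j)) M S X"
proof -
  have "shannon_entropy M (\<lambda>x. (tuple_rv X A x, S j x)) = shannon_entropy M (tuple_rv X A)"
    if "j \<in> {1..l}" "A \<in> upward_closure n (\<alpha> j)" for j A
    by (rule shannon_entropy_cong_kernel) (use authorized_determines_secret[OF that] in blast)
  \<comment> \<open>By the chain rule the entropies add up, because conditioning on the shares of an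
    unauthorized set does not lower the entropy of the secret.\<close>
  moreover have "shannon_entropy M (\<lambda>x. (tuple_rv X A x, S j x)) =
      shannon_entropy M (tuple_rv X A) + shannon_entropy M (S j)"
    if "j \<in> {1..l}" "A \<subseteq> {1..n}" "A \<notin> upward_closure n (\<alpha> j)" for j A
    using shannon_entropy_chain_rule[of "tuple_rv X A" "S j"]
      conditional_entropy_unauthorized[OF that, of "{}" snd] by simp
  moreover have "cond_shannon_entropy M (S j) (\<lambda>x. (tuple_rv S ({1..l} - {j}) x, tuple_rv X A x)) =
      shannon_entropy M (S j)"
    if "j \<in> {1..l}" "A \<subseteq> {1..n}" "A \<notin> upward_closure n (\<alpha> j)" for j A
    using conditional_entropy_unauthorized[OF that, of "{1..l} - {j}" "\<lambda>x. x"] by simp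
  ultimately show ?thesis
    unfolding combined_secret_sharing_def perfect_secret_sharing_def by simp
qed

text \<open>The combined secret sharing property yields the joint entropy of the secrets for which
  every member of \<open>As\<close> is authorized. That condition is
  \<open>\<alpha> j \<preceq> set As\<close>, and independence turns the joint entropy into a
  sum.\<close>

lemma shared_of_sets_eq:
  assumes I: "combined_secret_sharing_property I" and "1 \<le> n" "1 \<le> l"
    and As: "As \<noteq> []" "\<And>A. A \<in> set As \<Longrightarrow> A \<subseteq> {1..n}"
  shows "shared_of_sets I M (tuple_rv S {1..l}) X As = (\<Sum>j | j \<in> {1..l} \<and> \<alpha> j \<preceq> set As. shannon_entropy M (S j))"
proof -
  have "access_structure n (upward_closure n (\<alpha> j))" for j
    unfolding access_structure_def upward_closure_def by (auto; blast)
  then have "shared_of_sets I M (tuple_rv S {1..l}) X As =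
      shannon_entropy M (tuple_rv S {j\<in>{1..l}. \<forall>A\<in>set As. A \<in> upward_closure n (\<alpha> j)})"
    using I[unfolded combined_secret_sharing_property_def, rule_format,
      OF assms(2,3) _ prob_space_M combined_secret_sharing_M As(1)] As(2) by blast
  also have "{j\<in>{1..l}. \<forall>A\<in>set As. A \<in> upward_closure n (\<alpha> j)} = {j\<in>{1..l}. \<alpha> j \<preceq> set As}"
    using As(2) by (auto simp: upward_closure_def antichain_le_def)
  finally show ?thesis
    using entropy_tuple_secrets[OF Collect_subset[of "{1..l}" "\<lambda>j. \<alpha> j \<preceq> set As"]] by simp
qed

end

section \<open>Realizing prescribed partial information\<close>

theorem proposition1:
  fixes n :: nat and h :: "nat set set \<Rightarrow> real" and I :: "'w shared_info"
  assumes "infinite (UNIV :: 'w set)"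
    and "n \<ge> 1"
    and "\<And>\<alpha>. antichain n \<alpha> \<Longrightarrow> h \<alpha> \<ge> 0"
    and "shared_information_measure I"
    and "combined_secret_sharing_property I"
  shows "\<exists>(M :: 'w measure) S X.
           prob_space M \<and> simple_function M S \<and> (\<forall>i\<in>{1..n}. simple_function M (X i)) \<and>
           (\<forall>\<alpha>. antichain n \<alpha> \<longrightarrow> partial_information I n M S X \<alpha> = h \<alpha>)"
proof -
  define C where "C = {\<alpha>. antichain n \<alpha>}"
  define l where "l = card C"
  have fin: "finite C"
    unfolding C_def by (rule finite_antichains)
  obtain \<alpha> where \<alpha>: "bij_betw \<alpha> {1..l} C"
    using ex_bij_betw_nat_finite_1[OF fin] l_def by blast
  have antichain: "antichain n (\<alpha> j)" if "j \<in> {1..l}" for j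
    using \<alpha> that by (auto simp: bij_betw_def C_def)
  \<comment> \<open>This antichain guarantees at least one secret, as the combined secret sharing
    property demands.\<close>
  have "antichain n {{1}}"
    using \<open>n \<ge> 1\<close> by (auto simp: antichain_def)
  then have l: "1 \<le> l"
    using fin by (auto simp: l_def C_def card_gt_0_iff Suc_le_eq)
  \<comment> \<open>The exponent bounds every single \<open>h \<beta>\<close>, so the uniform
    distribution on \<open>N\<close> values has entropy at least \<open>h \<beta>\<close> for all
    antichains at once.\<close>
  define N :: int where "N = \<lceil>2 powr (\<Sum>\<beta>\<in>C. h \<beta>)\<rceil>"
  have N: "0 < N"
    by (simp add: N_def)
  have hN: "h \<beta> \<le> log 2 N" if "\<beta> \<in> C" for \<beta>
  proof -
    have "h \<beta> \<le> (\<Sum>\<beta>\<in>C. h \<beta>)"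
      using that fin assms(3) by (intro member_le_sum) (auto simp: C_def)
    also have "2 powr (\<Sum>\<beta>\<in>C. h \<beta>) \<le> N"
      unfolding N_def by linarith
    then have "(\<Sum>\<beta>\<in>C. h \<beta>) \<le> log 2 N"
      using N by (simp add: le_log_iff)
    finally show ?thesis .
  qed
  have "\<exists>p :: int \<Rightarrow> real. (\<forall>x. 0 \<le> p x) \<and> (\<Sum>x\<in>{0..<N}. p x) = 1 \<and>
      - (\<Sum>x\<in>{0..<N}. p x * log 2 (p x)) = h (\<alpha> j)" if "j \<in> {1..l}" for j
  proof (rule ex_distribution_with_entropy[OF N])
    show "0 \<le> h (\<alpha> j)"
      using antichain[OF that] by (rule assms(3))
    show "h (\<alpha> j) \<le> log 2 N"
      using antichain[OF that] by (intro hN) (simp add: C_def)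
  qed
  then obtain p :: "nat \<Rightarrow> int \<Rightarrow> real" where p: "\<And>j x. j \<in> {1..l} \<Longrightarrow> 0 \<le> p j x"
    "\<And>j. j \<in> {1..l} \<Longrightarrow> (\<Sum>x\<in>{0..<N}. p j x) = 1"
    "\<And>j. j \<in> {1..l} \<Longrightarrow> - (\<Sum>x\<in>{0..<N}. p j x * log 2 (p j x)) = h (\<alpha> j)"
    by metis
  define \<Omega> where "\<Omega> = ({1..l} \<times> Pow {1..n} \<times> {..n}) \<rightarrow>\<^sub>E {0..<N}"
  have "finite \<Omega>"
    unfolding \<Omega>_def by (intro finite_PiE) auto
  \<comment> \<open>An infinite type has room for a copy of the finite sample space.\<close>
  moreover obtain W :: "'w set" where "finite W" "card W = card \<Omega>"
    using infinite_arbitrarily_large[OF assms(1), of "card \<Omega>"] by auto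
  ultimately obtain dec where dec: "bij_betw dec W \<Omega>"
    by (metis finite_same_card_bij)
  interpret independent_sharing n l N \<alpha> p W dec
    by (rule independent_sharing.intro[OF N antichain p(1,2) dec[unfolded \<Omega>_def]])
  \<comment> \<open>By convention a Moebius inverse is 0 off the antichains, where \<open>h\<close>
    is arbitrary.\<close>
  define f where "f \<beta> = (if antichain n \<beta> then h \<beta> else 0)" for \<beta>
  have "moebius_inverse I n M (tuple_rv S {1..l}) X f"
    unfolding moebius_inverse_def
  proof (intro conjI allI impI)
    fix As assume "distinct As" and As: "antichain n (set As)"
    have "As \<noteq> []" "\<And>A. A \<in> set As \<Longrightarrow> A \<subseteq> {1..n}"
      using As by (auto simp: antichain_def)
    from shared_of_sets_eq[OF assms(5,2) l this]
    have "shared_of_sets I M (tuple_rv S {1..l}) X As =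
        (\<Sum>j | j \<in> {1..l} \<and> \<alpha> j \<preceq> set As. shannon_entropy M (S j))"
      by blast
    also have "\<dots> = (\<Sum>j | j \<in> {1..l} \<and> \<alpha> j \<preceq> set As. h (\<alpha> j))"
    proof (rule sum.cong)
      fix j assume "j \<in> {j. j \<in> {1..l} \<and> \<alpha> j \<preceq> set As}"
      then have j: "j \<in> {1..l}"
        by blast
      show "shannon_entropy M (S j) = h (\<alpha> j)"
        unfolding entropy_secret[OF j] by (rule p(3)[OF j])
    qed (rule refl)
    \<comment> \<open>The enumeration \<open>\<alpha>\<close> turns the sum over secrets into the
      sum over antichains below \<open>set As\<close>, which is the shape of Moebius
      inversion.\<close>
    also have "\<dots> = (\<Sum>\<beta> | antichain n \<beta> \<and> \<beta> \<preceq> set As. h \<beta>)"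
    proof (rule sum.reindex_bij_betw[where g = h])
      have "\<alpha> ` {j. j \<in> {1..l} \<and> \<alpha> j \<preceq> set As} = {\<beta>. \<beta> \<in> \<alpha> ` {1..l} \<and> \<beta> \<preceq> set As}"
        by blast
      also have "\<dots> = {\<beta>. antichain n \<beta> \<and> \<beta> \<preceq> set As}"
        unfolding bij_betw_imp_surj_on[OF \<alpha>] C_def mem_Collect_eq ..
      finally have "\<alpha> ` {j. j \<in> {1..l} \<and> \<alpha> j \<preceq> set As} = {\<beta>. antichain n \<beta> \<and> \<beta> \<preceq> set As}" .
      then show "bij_betw \<alpha> {j. j \<in> {1..l} \<and> \<alpha> j \<preceq> set As} {\<beta>. antichain n \<beta> \<and> \<beta> \<preceq> set As}"
        by (rule bij_betw_subset[OF \<alpha> Collect_subset[of "{1..l}" "\<lambda>j. \<alpha> j \<preceq> set As"]])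
    qed
    also have "\<dots> = (\<Sum>\<beta> | antichain n \<beta> \<and> \<beta> \<preceq> set As. f \<beta>)"
      by (rule sum.cong) (auto simp: f_def)
    finally show "shared_of_sets I M (tuple_rv S {1..l}) X As =
        (\<Sum>\<beta> | antichain n \<beta> \<and> \<beta> \<preceq> set As. f \<beta>)" .
  qed (simp add: f_def)
  then have "partial_information I n M (tuple_rv S {1..l}) X = f"
    by (rule partial_information_eqI)
  then show ?thesis
    using prob_space_M by (intro exI[of _ M] exI[of _ "tuple_rv S {1..l}"] exI[of _ X]) (simp add: f_def)
qed

end
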